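(* Let $\mathcal{E}$ be a Hilbert space and let $\mathcal{H}_{\mathcal{E}}(K)$ be the analytic reproducing kernel Hilbert space corresponding to an analytic kernel $K:\mathbb{D}\times\mathbb{D}\to\mathcal{B}(\mathcal{E})$. For $n\in\mathbb{Z}_+$ and $\eta\in\mathcal{E}$ let $K_{n,\eta}\in\mathcal{H}_{\mathcal{E}}(K)$ be the function $$K_{n,\eta}(z)=\Big(\frac{\partial^nK}{\partial\bar{w}^n}(z,0)\Big)\eta\qquad(z\in\mathbb{D}).$$ If the multiplication operator $M_z$ is bounded on $\mathcal{H}_{\mathcal{E}}(K)$, then $$M_z^*\Big(\frac{1}{n!}K_{n,\eta}\Big)=\begin{cases}\dfrac{1}{(n-1)!}K_{n-1,\eta}&\text{if }n\ge 1,\\[2mm]0&\text{if }n=0,\end{cases}$$ for all $\eta\in\mathcal{E}$.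
   Context: $\mathbb{D}$ is the open unit disc in $\mathbb{C}$ and $\mathbb{Z}_+=\{0,1,2,\dots\}$; inner products are linear in the first variable. For a Hilbert space $\mathcal{E}$, a function $K:\mathbb{D}\times\mathbb{D}\to\mathcal{B}(\mathcal{E})$ is an analytic kernel if $K$ is analytic in the first variable and $\sum_{i,j=1}^n\langle K(z_i,z_j)\eta_j,\eta_i\rangle_{\mathcal{E}}\ge 0$ for all $n\in\mathbb{N}$, $z_1,\dots,z_n\in\mathbb{D}$, $\eta_1,\dots,\eta_n\in\mathcal{E}$. (Then $K(z,w)^*=K(w,z)$, so $K$ is co-analytic in $w$ and derivatives in $\bar w$ make sense.) The corresponding analytic reproducing kernel Hilbert space $\mathcal{H}_{\mathcal{E}}(K)$ is the Hilbert space of $\mathcal{E}$-valued analytic functions on $\mathbb{D}$ in which $\{K(\cdot,w)\eta: w\in\mathbb{D},\eta\in\mathcal{E}\}$ is total and $\langle f,K(\cdot,w)\eta\rangle_{\mathcal{H}_{\mathcal{E}}(K)}=\langle f(w),\eta\rangle_{\mathcal{E}}$ for all $f\in\mathcal{H}_{\mathcal{E}}(K)$, $w\in\mathbb{D}$, $\eta\in\mathcal{E}$. $M_z$ is the operator $(M_zf)(w)=wf(w)$; "$M_z$ is bounded on $\mathcal{H}_{\mathcal{E}}(K)$" means it maps this space into itself as a bounded operator, and $M_z^*$ is its adjoint. *)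

theory Defs
  imports "HOL-Analysis.Analysis" "HOL-Library.Function_Algebras"
begin

class complex_vector = ab_group_add +
  fixes scaleC :: "complex \<Rightarrow> 'a \<Rightarrow> 'a"  (infixr "*\<^sub>C" 75)
  assumes scaleC_add_right: "a *\<^sub>C (x + y) = a *\<^sub>C x + a *\<^sub>C y"
    and scaleC_add_left: "(a + b) *\<^sub>C x = a *\<^sub>C x + b *\<^sub>C x"
    and scaleC_scaleC: "a *\<^sub>C b *\<^sub>C x = (a * b) *\<^sub>C x"
    and scaleC_one: "1 *\<^sub>C x = x"

global_interpretation complex_vector:
  vector_space "scaleC :: complex \<Rightarrow> 'a \<Rightarrow> 'a::complex_vector"
  by unfold_locales (simp_all add: scaleC_add_right scaleC_add_left scaleC_scaleC scaleC_one)

class complex_normed_vector = complex_vector + real_normed_vector +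
  assumes scaleR_scaleC: "r *\<^sub>R x = complex_of_real r *\<^sub>C x"
    and norm_scaleC: "norm (a *\<^sub>C x) = norm a * norm x"

class complex_hilbert = complex_normed_vector + banach +
  fixes cinner :: "'a \<Rightarrow> 'a \<Rightarrow> complex"
  assumes cinner_add_left: "cinner (x + y) z = cinner x z + cinner y z"
    and cinner_scaleC_left: "cinner (a *\<^sub>C x) y = a * cinner x y"
    and cinner_commute: "cinner x y = cnj (cinner y x)"
    and cinner_self: "cinner x x = complex_of_real ((norm x)\<^sup>2)"

instantiation "fun" :: (type, complex_vector) complex_vector
begin

definition scaleC_fun_def: "a *\<^sub>C f = (\<lambda>x. a *\<^sub>C f x)"

instance
  by standard
    (simp_all add: scaleC_fun_def fun_eq_iff scaleC_add_right scaleC_add_left scaleC_scaleC scaleC_one)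

end

lemma bounded_linear_scaleC_right:
  "bounded_linear (\<lambda>x. a *\<^sub>C (x :: 'a::complex_normed_vector))"
proof (rule bounded_linear_intro[where K = "norm a"])
  fix r :: real and x y :: 'a
  show "a *\<^sub>C (x + y) = a *\<^sub>C x + a *\<^sub>C y" by (rule scaleC_add_right)
  show "a *\<^sub>C r *\<^sub>R x = r *\<^sub>R a *\<^sub>C x"
    by (simp add: scaleR_scaleC scaleC_scaleC mult.commute)
  show "norm (a *\<^sub>C x) \<le> norm x * norm a" by (simp add: norm_scaleC mult.commute)
qed

instantiation blinfun :: (real_normed_vector, complex_normed_vector) complex_normed_vector
begin

lift_definition scaleC_blinfun :: "complex \<Rightarrow> ('a \<Rightarrow>\<^sub>L 'b) \<Rightarrow> ('a \<Rightarrow>\<^sub>L 'b)"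
  is "\<lambda>a f x. a *\<^sub>C f x"
  by (rule bounded_linear_compose[OF bounded_linear_scaleC_right])

instance
proof
  fix a b :: complex and r :: real and f g :: "'a \<Rightarrow>\<^sub>L 'b"
  show "a *\<^sub>C (f + g) = a *\<^sub>C f + a *\<^sub>C g"
    by transfer (simp add: scaleC_add_right)
  show "(a + b) *\<^sub>C f = a *\<^sub>C f + b *\<^sub>C f"
    by transfer (simp add: scaleC_add_left)
  show "a *\<^sub>C b *\<^sub>C f = (a * b) *\<^sub>C f"
    by transfer (simp add: scaleC_scaleC)
  show "1 *\<^sub>C f = f"
    by transfer (simp add: scaleC_one)
  show "r *\<^sub>R f = complex_of_real r *\<^sub>C f"
    by transfer (simp add: scaleR_scaleC)
  have le: "norm (c *\<^sub>C h) \<le> norm c * norm h" for c and h :: "'a \<Rightarrow>\<^sub>L 'b"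
  proof (rule norm_blinfun_bound)
    fix x
    have "norm (blinfun_apply (c *\<^sub>C h) x) = norm c * norm (blinfun_apply h x)"
      by (simp add: scaleC_blinfun.rep_eq norm_scaleC)
    also have "\<dots> \<le> norm c * (norm h * norm x)"
      by (intro mult_left_mono norm_blinfun) simp
    finally show "norm (blinfun_apply (c *\<^sub>C h) x) \<le> norm c * norm h * norm x"
      by (simp add: mult.assoc)
  qed simp
  show "norm (a *\<^sub>C f) = norm a * norm f"
  proof (cases "a = 0")
    case True
    then show ?thesis using le[of a f] by simp
  next
    case False
    have "inverse a *\<^sub>C a *\<^sub>C f = f"
      using False by transfer (simp add: scaleC_scaleC scaleC_one)
    then have "norm f \<le> norm (inverse a) * norm (a *\<^sub>C f)"
      using le[of "inverse a" "a *\<^sub>C f"] by simp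
    then have "norm a * norm f \<le> norm (a *\<^sub>C f)"
      using False by (simp add: norm_divide field_simps)
    then show ?thesis using le[of a f] by simp
  qed
qed

end

text \<open>
  A complex Hilbert space whose vectors form a subset \<open>H\<close> of a complex vector space, with an inner
  product \<open>ip\<close> that is relevant only on \<open>H\<close>.
\<close>

definition norm_on :: "('v \<Rightarrow> 'v \<Rightarrow> complex) \<Rightarrow> 'v \<Rightarrow> real" where
  "norm_on ip f = sqrt (Re (ip f f))"

locale hilbert_space_on =
  fixes H :: "'v::complex_vector set" and ip :: "'v \<Rightarrow> 'v \<Rightarrow> complex"
  assumes subspace: "complex_vector.subspace H"
    and ip_add_left: "\<lbrakk>f \<in> H; g \<in> H; h \<in> H\<rbrakk> \<Longrightarrow> ip (f + g) h = ip f h + ip g h"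
    and ip_scaleC_left: "\<lbrakk>f \<in> H; g \<in> H\<rbrakk> \<Longrightarrow> ip (a *\<^sub>C f) g = a * ip f g"
    and ip_commute: "\<lbrakk>f \<in> H; g \<in> H\<rbrakk> \<Longrightarrow> ip f g = cnj (ip g f)"
    and ip_self_nonneg: "f \<in> H \<Longrightarrow> ip f f \<in> \<real>\<^sub>\<ge>\<^sub>0"
    and ip_self_eq_0: "\<lbrakk>f \<in> H; ip f f = 0\<rbrakk> \<Longrightarrow> f = 0"
    and complete: "\<lbrakk>\<And>n::nat. X n \<in> H;
        \<And>e. 0 < e \<Longrightarrow> \<exists>N. \<forall>m\<ge>N. \<forall>n\<ge>N. norm_on ip (X m - X n) < e\<rbrakk>
      \<Longrightarrow> \<exists>f\<in>H. (\<lambda>n. norm_on ip (X n - f)) \<longlonglongrightarrow> 0"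

definition bounded_operator_on ::
  "'v::complex_vector set \<Rightarrow> ('v \<Rightarrow> 'v \<Rightarrow> complex) \<Rightarrow> ('v \<Rightarrow> 'v) \<Rightarrow> bool" where
  "bounded_operator_on H ip T \<longleftrightarrow>
     (\<forall>f\<in>H. T f \<in> H) \<and>
     (\<forall>f\<in>H. \<forall>g\<in>H. T (f + g) = T f + T g) \<and>
     (\<forall>a. \<forall>f\<in>H. T (a *\<^sub>C f) = a *\<^sub>C T f) \<and>
     (\<exists>C. \<forall>f\<in>H. norm_on ip (T f) \<le> C * norm_on ip f)"

definition adjoint_on :: "'v set \<Rightarrow> ('v \<Rightarrow> 'v \<Rightarrow> complex) \<Rightarrow> ('v \<Rightarrow> 'v) \<Rightarrow> 'v \<Rightarrow> 'v" where
  "adjoint_on H ip T g = (THE h. h \<in> H \<and> (\<forall>f\<in>H. ip (T f) g = ip f h))"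

text \<open>For operator-valued functions differentiability is in the operator norm.\<close>

definition analytic_vec_on :: "(complex \<Rightarrow> 'a::complex_normed_vector) \<Rightarrow> complex set \<Rightarrow> bool" where
  "analytic_vec_on f S \<longleftrightarrow>
     open S \<and> (\<forall>z\<in>S. \<exists>D. (f has_derivative (\<lambda>h. h *\<^sub>C D)) (at z))"

text \<open>$\partial f/\partial\bar w = \frac12(\partial f/\partial x + i\,\partial f/\partial y)$,
  where $w = x + iy$.\<close>

definition deriv_cnj :: "(complex \<Rightarrow> 'a::complex_normed_vector) \<Rightarrow> complex \<Rightarrow> 'a" where
  "deriv_cnj f w =
     (1 / 2) *\<^sub>C (frechet_derivative f (at w) 1 + \<i> *\<^sub>C frechet_derivative f (at w) \<i>)"

abbreviation disc :: "complex set" where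
  "disc \<equiv> ball 0 1"

text \<open>Functions on the disc are represented by total functions that vanish off the disc.\<close>

definition on_disc :: "(complex \<Rightarrow> 'e::zero) \<Rightarrow> complex \<Rightarrow> 'e" where
  "on_disc f = (\<lambda>z. if z \<in> disc then f z else 0)"

text \<open>Elements of \<open>'e \<Rightarrow>\<^sub>L 'e\<close> are only real-linear, so complex linearity is required separately.\<close>

definition analytic_kernel :: "(complex \<Rightarrow> complex \<Rightarrow> 'e::complex_hilbert \<Rightarrow>\<^sub>L 'e) \<Rightarrow> bool" where
  "analytic_kernel K \<longleftrightarrow>
     (\<forall>z\<in>disc. \<forall>w\<in>disc. Vector_Spaces.linear scaleC scaleC (blinfun_apply (K z w))) \<and>
     (\<forall>w\<in>disc. analytic_vec_on (\<lambda>z. K z w) disc) \<and>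
     (\<forall>(n::nat) (z :: nat \<Rightarrow> complex) (\<eta> :: nat \<Rightarrow> 'e). (\<forall>i<n. z i \<in> disc) \<longrightarrow>
        (\<Sum>i<n. \<Sum>j<n. cinner (blinfun_apply (K (z i) (z j)) (\<eta> j)) (\<eta> i)) \<in> \<real>\<^sub>\<ge>\<^sub>0)"

definition kernel_fun ::
  "(complex \<Rightarrow> complex \<Rightarrow> 'e::complex_hilbert \<Rightarrow>\<^sub>L 'e) \<Rightarrow> complex \<Rightarrow> 'e \<Rightarrow> complex \<Rightarrow> 'e" where
  "kernel_fun K w \<eta> = on_disc (\<lambda>z. blinfun_apply (K z w) \<eta>)"

locale analytic_rkhs = hilbert_space_on H ip
  for K :: "complex \<Rightarrow> complex \<Rightarrow> 'e::complex_hilbert \<Rightarrow>\<^sub>L 'e"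
    and H :: "(complex \<Rightarrow> 'e) set"
    and ip :: "(complex \<Rightarrow> 'e) \<Rightarrow> (complex \<Rightarrow> 'e) \<Rightarrow> complex" +
  assumes analytic: "f \<in> H \<Longrightarrow> analytic_vec_on f disc"
    and zero_off_disc: "\<lbrakk>f \<in> H; z \<notin> disc\<rbrakk> \<Longrightarrow> f z = 0"
    and kernel_fun_in: "w \<in> disc \<Longrightarrow> kernel_fun K w \<eta> \<in> H"
    and total: "\<lbrakk>f \<in> H; 0 < e\<rbrakk> \<Longrightarrow>
      \<exists>g \<in> complex_vector.span {kernel_fun K w \<eta> | w \<eta>. w \<in> disc}. norm_on ip (f - g) < e"
    and reproducing: "\<lbrakk>f \<in> H; w \<in> disc\<rbrakk> \<Longrightarrow> ip f (kernel_fun K w \<eta>) = cinner (f w) \<eta>"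

definition kernel_deriv ::
  "(complex \<Rightarrow> complex \<Rightarrow> 'e::complex_hilbert \<Rightarrow>\<^sub>L 'e) \<Rightarrow> nat \<Rightarrow> 'e \<Rightarrow> complex \<Rightarrow> 'e" where
  "kernel_deriv K n \<eta> = on_disc (\<lambda>z. blinfun_apply ((deriv_cnj ^^ n) (\<lambda>w. K z w) 0) \<eta>)"

definition mult_z :: "(complex \<Rightarrow> 'e::complex_vector) \<Rightarrow> complex \<Rightarrow> 'e" where
  "mult_z f = (\<lambda>w. w *\<^sub>C f w)"

end

theory Submission
  imports Defs "HOL-Complex_Analysis.Complex_Analysis"
begin

text \<open>
  For \<open>f\<close> in the space, \<open>\<langle>f, K\<^sub>n\<^sub>,\<^sub>\<eta> / n!\<rangle>\<close> is the \<open>n\<close>-th Taylor coefficient at 0 of \<open>\<langle>f(\<cdot>), \<eta>\<rangle>\<close>.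
  Multiplication by \<open>z\<close> shifts Taylor coefficients, so its adjoint shifts the representing
  vectors. That the \<open>n\<close>-th coefficient is represented by a vector of the space follows, by induction
  on \<open>n\<close>, from the uniform boundedness principle; the reproducing property identifies
  this vector with \<open>K\<^sub>n\<^sub>,\<^sub>\<eta> / n!\<close>, where \<open>K(z, \<cdot>)\<close> is differentiable in operator norm because it is
  the adjoint of \<open>K(\<cdot>, z)\<close>, hence weakly antiholomorphic and locally bounded.
\<close>

section \<open>Hilbert spaces on a carrier set\<close>

context hilbert_space_on
begin

lemma zero_in: "0 \<in> H"
  and add_in: "f \<in> H \<Longrightarrow> g \<in> H \<Longrightarrow> f + g \<in> H"
  and scaleC_in: "f \<in> H \<Longrightarrow> a *\<^sub>C f \<in> H"
  and diff_in: "f \<in> H \<Longrightarrow> g \<in> H \<Longrightarrow> f - g \<in> H"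
  and sum_in: "(\<And>i. i \<in> I \<Longrightarrow> F i \<in> H) \<Longrightarrow> sum F I \<in> H"
  using subspace complex_vector.subspace_0 complex_vector.subspace_add
    complex_vector.subspace_scale complex_vector.subspace_diff complex_vector.subspace_sum
  by blast+

lemma ip_diff_left: "\<lbrakk>f \<in> H; g \<in> H; h \<in> H\<rbrakk> \<Longrightarrow> ip (f - g) h = ip f h - ip g h"
  using ip_add_left[of "f - g" g h] diff_in[of f g] by (simp add: algebra_simps)

lemma ip_add_right: "\<lbrakk>f \<in> H; g \<in> H; h \<in> H\<rbrakk> \<Longrightarrow> ip h (f + g) = ip h f + ip h g"
  by (metis add_in complex_cnj_add ip_add_left ip_commute)

lemma ip_diff_right: "\<lbrakk>f \<in> H; g \<in> H; h \<in> H\<rbrakk> \<Longrightarrow> ip h (f - g) = ip h f - ip h g"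
  by (metis diff_in complex_cnj_diff ip_diff_left ip_commute)

lemma ip_scaleC_right: "\<lbrakk>f \<in> H; h \<in> H\<rbrakk> \<Longrightarrow> ip h (a *\<^sub>C f) = cnj a * ip h f"
  by (metis scaleC_in complex_cnj_mult ip_scaleC_left ip_commute)

lemma ip_zero_right: "f \<in> H \<Longrightarrow> ip f 0 = 0"
  using ip_diff_right[of f f f] by simp

lemma ip_sum_right:
  "\<lbrakk>\<And>i. i \<in> I \<Longrightarrow> F i \<in> H; h \<in> H\<rbrakk> \<Longrightarrow> ip h (sum F I) = (\<Sum>i\<in>I. ip h (F i))"
  by (induction I rule: infinite_finite_induct) (auto simp: ip_zero_right ip_add_right sum_in)

lemma norm_on_nonneg: "f \<in> H \<Longrightarrow> 0 \<le> norm_on ip f"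
  using ip_self_nonneg[of f] by (auto simp: norm_on_def elim!: nonneg_Reals_cases)

lemma norm_on_square: "f \<in> H \<Longrightarrow> ip f f = complex_of_real ((norm_on ip f)\<^sup>2)"
  using ip_self_nonneg[of f]
  by (auto simp: norm_on_def simp flip: of_real_power elim!: nonneg_Reals_cases)

lemma norm_on_eq_0: "\<lbrakk>f \<in> H; norm_on ip f = 0\<rbrakk> \<Longrightarrow> f = 0"
  using norm_on_square ip_self_eq_0 by fastforce

lemma norm_on_scaleC:
  assumes "f \<in> H"
  shows "norm_on ip (a *\<^sub>C f) = cmod a * norm_on ip f"
proof -
  have "complex_of_real ((norm_on ip (a *\<^sub>C f))\<^sup>2) = a * (cnj a * ip f f)"
    using norm_on_square[of "a *\<^sub>C f"] assms
    by (simp add: ip_scaleC_left ip_scaleC_right scaleC_in mult.left_commute)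
  also have "\<dots> = complex_of_real ((cmod a * norm_on ip f)\<^sup>2)"
    using norm_on_square[OF assms] complex_norm_square[of a] by (simp add: power_mult_distrib)
  finally have "(norm_on ip (a *\<^sub>C f))\<^sup>2 = (cmod a * norm_on ip f)\<^sup>2"
    using of_real_eq_iff by blast
  then show ?thesis
    by (rule power2_eq_imp_eq) (simp_all add: assms norm_on_nonneg scaleC_in)
qed

lemma Cauchy_Schwarz:
  assumes f: "f \<in> H" and g: "g \<in> H"
  shows "cmod (ip f g) \<le> norm_on ip f * norm_on ip g"
proof (cases "norm_on ip g = 0")
  case True
  then show ?thesis using norm_on_eq_0[OF g] ip_zero_right[OF f] by simp
next
  case False
  define G where "G = (norm_on ip g)\<^sup>2"
  have G: "G > 0" using False by (simp add: G_def)
  \<comment> \<open>\<open>a\<close> is the coefficient of the orthogonal projection of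
    \<open>f\<close> onto \<open>g\<close>, so the squared norm of \<open>?d\<close> below is the
    defect in the inequality divided by \<open>G\<close>.\<close>
  define a where "a = ip f g / G"
  have gg: "ip g g = of_real G" and ff: "ip f f = of_real ((norm_on ip f)\<^sup>2)"
    using norm_on_square f g by (auto simp: G_def)
  have gf: "ip g f = cnj (ip f g)" using ip_commute f g by blast
  let ?d = "f - a *\<^sub>C g"
  have d: "?d \<in> H" using f g diff_in scaleC_in by blast
  have "ip ?d ?d = ip f f - cnj a * ip f g - a * ip g f + a * cnj a * ip g g"
    using f g by (simp add: ip_diff_left ip_diff_right ip_scaleC_left ip_scaleC_right diff_in
        scaleC_in algebra_simps)
  also have "\<dots> = of_real ((norm_on ip f)\<^sup>2 - (cmod (ip f g))\<^sup>2 / G)"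
    using G by (simp add: gg ff gf a_def complex_norm_square field_simps flip: of_real_power)
  finally have "complex_of_real ((norm_on ip ?d)\<^sup>2)
      = of_real ((norm_on ip f)\<^sup>2 - (cmod (ip f g))\<^sup>2 / G)"
    using norm_on_square[OF d] by simp
  then have "(norm_on ip ?d)\<^sup>2 = (norm_on ip f)\<^sup>2 - (cmod (ip f g))\<^sup>2 / G"
    using of_real_eq_iff by blast
  then have "(cmod (ip f g))\<^sup>2 / G \<le> (norm_on ip f)\<^sup>2"
    by (metis diff_ge_0_iff_ge zero_le_power2)
  then have "(cmod (ip f g))\<^sup>2 \<le> (norm_on ip f * norm_on ip g)\<^sup>2"
    using G by (simp add: G_def power_mult_distrib pos_divide_le_eq)
  then show ?thesis
    by (rule power2_le_imp_le) (simp add: f g norm_on_nonneg)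
qed

lemma norm_on_triangle:
  assumes f: "f \<in> H" and g: "g \<in> H"
  shows "norm_on ip (f + g) \<le> norm_on ip f + norm_on ip g"
proof -
  have "Re (ip (f + g) (f + g)) = Re (ip f f) + Re (ip g g) + 2 * Re (ip f g)"
    using f g ip_commute[of g f] by (simp add: ip_add_left ip_add_right add_in)
  also have "\<dots> \<le> (norm_on ip f)\<^sup>2 + (norm_on ip g)\<^sup>2 + 2 * (norm_on ip f * norm_on ip g)"
    using complex_Re_le_cmod[of "ip f g"] Cauchy_Schwarz[OF f g]
      norm_on_square[OF f] norm_on_square[OF g] by simp
  finally have "(norm_on ip (f + g))\<^sup>2 \<le> (norm_on ip f + norm_on ip g)\<^sup>2"
    using norm_on_square[OF add_in[OF f g]] by (simp add: power2_sum)
  then show ?thesis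
    by (rule power2_le_imp_le) (simp add: f g norm_on_nonneg)
qed

lemma norm_on_minus_commute:
  assumes "f \<in> H" "g \<in> H"
  shows "norm_on ip (f - g) = norm_on ip (g - f)"
proof -
  have "(- 1) *\<^sub>C (f - g) = g - f"
    by (metis complex_vector.scale_minus_left minus_diff_eq scaleC_one)
  then show ?thesis using norm_on_scaleC[of "f - g" "- 1"] diff_in assms by simp
qed

lemma norm_on_triangle_diff:
  assumes "f \<in> H" "g \<in> H" "h \<in> H"
  shows "norm_on ip (f - h) \<le> norm_on ip (f - g) + norm_on ip (g - h)"
  using norm_on_triangle[of "f - g" "g - h"] assms diff_in by simp

lemma ip_tendsto_right:
  assumes "\<And>n. X n \<in> H" "c \<in> H" "f \<in> H" and lim: "(\<lambda>n. norm_on ip (X n - c)) \<longlonglongrightarrow> 0"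
  shows "(\<lambda>n. ip f (X n)) \<longlonglongrightarrow> ip f c"
proof -
  have "cmod (ip f (X n) - ip f c) \<le> norm_on ip f * norm_on ip (X n - c)" for n
    using Cauchy_Schwarz[of f "X n - c"] assms by (simp add: ip_diff_right diff_in)
  then have "(\<lambda>n. ip f (X n) - ip f c) \<longlonglongrightarrow> 0"
    by (intro Lim_null_comparison[OF _ tendsto_mult_right_zero[OF lim, of "norm_on ip f"]]) simp
  then show ?thesis by (simp add: LIM_zero_iff)
qed

lemma ip_ext:
  assumes "g \<in> H" "h \<in> H" "\<And>f. f \<in> H \<Longrightarrow> ip f g = ip f h"
  shows "g = h"
proof -
  have "ip (g - h) (g - h) = 0"
    using assms by (simp add: ip_diff_right diff_in)
  then show ?thesis using ip_self_eq_0 assms diff_in by fastforce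
qed

text \<open>\<open>adjoint_on\<close> is a definite description, so it is evaluated by exhibiting a
  representing vector; \<open>ip_ext\<close> gives uniqueness.\<close>

lemma adjoint_on_eqI:
  assumes "h \<in> H" "\<And>f. f \<in> H \<Longrightarrow> ip (T f) g = ip f h"
  shows "adjoint_on H ip T g = h"
  unfolding adjoint_on_def
proof (rule the_equality)
  show "h' = h" if "h' \<in> H \<and> (\<forall>f\<in>H. ip (T f) g = ip f h')" for h'
    using that assms by (intro ip_ext) auto
qed (use assms in blast)

text \<open>Gliding hump: one of \<open>x \<plusminus> u\<close>, with \<open>u\<close> a multiple of \<open>g\<close>, pairs with \<open>g\<close> at least as
  strongly as \<open>u\<close> does.\<close>

lemma uniform_boundedness:
  assumes A: "A \<subseteq> H" and pw: "\<And>f. f \<in> H \<Longrightarrow> \<exists>C. \<forall>g\<in>A. cmod (ip f g) \<le> C"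
  shows "\<exists>C. \<forall>g\<in>A. norm_on ip g \<le> C"
proof (rule ccontr)
  assume "\<not> ?thesis"
  \<comment> \<open>The rate \<open>4 ^ n\<close> is set against steps of length
    \<open>(1/3) ^ Suc n\<close>: the steps are summable, with all later ones adding up to at most
    half of the current one, while \<open>(4/3) ^ n\<close> still diverges.\<close>
  then have "\<forall>n::nat. \<exists>g. g \<in> A \<and> 4 ^ n < norm_on ip g"
    by (meson not_le_imp_less)
  then obtain g where gA: "\<And>n. g n \<in> A" and g4: "\<And>n. 4 ^ n < norm_on ip (g n)"
    by metis
  have gH: "g n \<in> H" for n using gA A by blast
  have gpos: "0 < norm_on ip (g n)" for n
    using g4[of n] by (meson less_trans zero_less_numeral zero_less_power)
  have step: "\<exists>y. y \<in> H \<and> norm_on ip (y - x) \<le> (1/3) ^ Suc n \<and>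
      (1/3) ^ Suc n * norm_on ip (g n) \<le> cmod (ip y (g n))" if x: "x \<in> H" for x n
  proof -
    define u where "u = complex_of_real ((1/3) ^ Suc n / norm_on ip (g n)) *\<^sub>C g n"
    have u: "u \<in> H" using gH scaleC_in u_def by blast
    have nu: "norm_on ip u = (1/3) ^ Suc n"
      using gpos[of n] unfolding u_def norm_on_scaleC[OF gH] by (simp add: norm_divide norm_power)
    have "ip u (g n) = of_real ((1/3) ^ Suc n * norm_on ip (g n))"
      using gpos[of n] unfolding u_def ip_scaleC_left[OF gH gH] norm_on_square[OF gH]
      by (simp add: power2_eq_square)
    moreover have "2 * ip u (g n) = ip (x + u) (g n) - ip (x - u) (g n)"
      using x u gH by (simp add: ip_add_left ip_diff_left)
    ultimately have "2 * ((1/3) ^ Suc n * norm_on ip (g n))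
        = cmod (ip (x + u) (g n) - ip (x - u) (g n))"
      using gpos[of n] by (metis abs_of_pos mult_pos_pos norm_mult norm_numeral norm_of_real
          zero_less_divide_1_iff zero_less_numeral zero_less_power)
    also have "\<dots> \<le> cmod (ip (x + u) (g n)) + cmod (ip (x - u) (g n))"
      by (rule norm_triangle_ineq4)
    finally consider "(1/3) ^ Suc n * norm_on ip (g n) \<le> cmod (ip (x + u) (g n))"
      | "(1/3) ^ Suc n * norm_on ip (g n) \<le> cmod (ip (x - u) (g n))"
      by linarith
    then show ?thesis
    proof cases
      case 1
      then show ?thesis using x u nu add_in by (intro exI[of _ "x + u"]) auto
    next
      case 2
      have "norm_on ip ((x - u) - x) = norm_on ip u"
        using norm_on_minus_commute[of "x - u" x] x u diff_in by simp
      then show ?thesis using 2 x u nu diff_in by (intro exI[of _ "x - u"]) auto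
    qed
  qed
  have "\<exists>x. \<forall>n::nat. x n \<in> H \<and> (norm_on ip (x (Suc n) - x n) \<le> (1/3) ^ Suc n \<and>
      (1/3) ^ Suc n * norm_on ip (g n) \<le> cmod (ip (x (Suc n)) (g n)))"
    using zero_in step by (intro dependent_nat_choice) auto
  then obtain x where xH: "\<And>n. x n \<in> H"
    and xs: "\<And>n. norm_on ip (x (Suc n) - x n) \<le> (1/3) ^ Suc n"
    and xg: "\<And>n. (1/3) ^ Suc n * norm_on ip (g n) \<le> cmod (ip (x (Suc n)) (g n))"
    by blast
  \<comment> \<open>The right-hand side is the exact value of the geometric sum of
    \<open>(1/3) ^ j\<close> over \<open>n < j \<le> n + k\<close>, which lets the induction
    close.\<close>
  have far: "norm_on ip (x (n + k) - x n) \<le> ((1/3) ^ n - (1/3) ^ (n + k)) / 2" for n k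
  proof (induction k)
    case 0
    then show ?case using norm_on_scaleC[OF zero_in, of 0] by simp
  next
    case (Suc k)
    have "norm_on ip (x (n + Suc k) - x n)
        \<le> norm_on ip (x (Suc (n + k)) - x (n + k)) + norm_on ip (x (n + k) - x n)"
      using norm_on_triangle_diff[OF xH xH xH] by simp
    also have "\<dots> \<le> (1/3) ^ Suc (n + k) + ((1/3) ^ n - (1/3) ^ (n + k)) / 2"
      using xs Suc.IH by (intro add_mono) auto
    finally show ?case by (simp add: field_simps)
  qed
  have far': "norm_on ip (x m - x n) \<le> (1/3) ^ n / 2" if "n \<le> m" for m n
  proof -
    have "norm_on ip (x m - x n) \<le> ((1/3) ^ n - (1/3) ^ m) / 2"
      using far[of n "m - n"] that by simp
    also have "\<dots> \<le> (1/3) ^ n / 2"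
      by (intro divide_right_mono) simp_all
    finally show ?thesis .
  qed
  have "\<exists>f\<in>H. (\<lambda>n. norm_on ip (x n - f)) \<longlonglongrightarrow> 0"
  proof (rule complete[OF xH])
    fix e :: real assume "0 < e"
    then obtain N where N: "(1/3) ^ N < e"
      using real_arch_pow_inv[of e "1/3"] by auto
    have "norm_on ip (x m - x n) < e" if "N \<le> m" "N \<le> n" for m n
      using far'[OF that(1)] far'[OF that(2)] norm_on_triangle_diff[OF xH xH xH, of m n N]
        norm_on_minus_commute[OF xH xH, of N n] N by linarith
    then show "\<exists>N. \<forall>m\<ge>N. \<forall>n\<ge>N. norm_on ip (x m - x n) < e"
      by blast
  qed
  then obtain f where f: "f \<in> H" and lim: "(\<lambda>n. norm_on ip (x n - f)) \<longlonglongrightarrow> 0"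
    by blast
  \<comment> \<open>\<open>far'\<close> passes to the limit by the triangle inequality through
    \<open>x m\<close>, whose distance to \<open>f\<close> tends to 0.\<close>
  have near: "norm_on ip (f - x n) \<le> (1/3) ^ n / 2" for n
  proof (rule LIMSEQ_le_const)
    show "(\<lambda>m. norm_on ip (x m - f) + (1/3) ^ n / 2) \<longlonglongrightarrow> (1/3) ^ n / 2"
      using tendsto_add[OF lim tendsto_const] by simp
    show "\<exists>N. \<forall>m\<ge>N. norm_on ip (f - x n) \<le> norm_on ip (x m - f) + (1/3) ^ n / 2"
    proof (intro exI allI impI)
      fix m assume "n \<le> m"
      then show "norm_on ip (f - x n) \<le> norm_on ip (x m - f) + (1/3) ^ n / 2"
        using norm_on_triangle_diff[OF f xH xH, of n m] far' norm_on_minus_commute[OF f xH, of m]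
        by fastforce
    qed
  qed
  obtain C where C: "\<And>n. cmod (ip f (g n)) \<le> C"
    using pw[OF f] gA by blast
  \<comment> \<open>Replacing \<open>x (Suc n)\<close> by the limit \<open>f\<close> costs at most
    half of the hump \<open>(1/3) ^ Suc n * norm_on ip (g n)\<close>. The other half is bounded by
    \<open>C\<close>; clearing the factors 2 and 3 gives \<open>6 * C\<close>.\<close>
  have "(4/3) ^ n \<le> 6 * C" for n
  proof -
    have "cmod (ip (f - x (Suc n)) (g n)) \<le> norm_on ip (f - x (Suc n)) * norm_on ip (g n)"
      using Cauchy_Schwarz f xH gH diff_in by blast
    also have "\<dots> \<le> (1/3) ^ Suc n / 2 * norm_on ip (g n)"
      using near[of "Suc n"] gpos[of n] by (intro mult_right_mono) simp_all
    finally have tail: "cmod (ip (f - x (Suc n)) (g n)) \<le> (1/3) ^ Suc n / 2 * norm_on ip (g n)" .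
    have "ip (x (Suc n)) (g n) = ip f (g n) - ip (f - x (Suc n)) (g n)"
      using f xH gH by (simp add: ip_diff_left)
    then have "(1/3) ^ Suc n * norm_on ip (g n) \<le> cmod (ip f (g n) - ip (f - x (Suc n)) (g n))"
      using xg[of n] by (simp only:)
    also have "\<dots> \<le> cmod (ip f (g n)) + cmod (ip (f - x (Suc n)) (g n))"
      by (rule norm_triangle_ineq4)
    also have "\<dots> \<le> C + (1/3) ^ Suc n / 2 * norm_on ip (g n)"
      by (rule add_mono[OF C tail])
    finally have "(1/3) ^ n * norm_on ip (g n) \<le> 6 * C"
      by (simp add: field_simps)
    moreover have "(1/3) ^ n * 4 ^ n \<le> (1/3) ^ n * norm_on ip (g n)"
      using g4[of n] by (intro mult_left_mono) auto
    ultimately show ?thesis by (simp add: power_divide)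
  qed
  moreover obtain n where "6 * C < (4/3) ^ n"
    using real_arch_pow[of "4/3" "6 * C"] by auto
  ultimately show False
    using leD by blast
qed

text \<open>Completeness turns a quantitative weak limit into a representing vector without the Riesz
  theorem: by uniform boundedness the sequence is Cauchy in norm.\<close>

lemma ex_representing_limit:
  assumes g: "\<And>m::nat. g m \<in> H" and e: "\<And>m. 0 < e m" "e \<longlonglongrightarrow> 0"
    and L: "\<And>f. f \<in> H \<Longrightarrow> \<exists>C. \<forall>m. cmod (ip f (g m) - L f) \<le> C * e m"
  shows "\<exists>c\<in>H. \<forall>f\<in>H. ip f c = L f"
proof -
  \<comment> \<open>Differences are normalised by the combined error rate. Each \<open>f\<close>
    pairs boundedly with all of them, since \<open>L f\<close> cancels, so a uniform norm bound on
    \<open>?q\<close> is a Cauchy estimate for \<open>g\<close>.\<close>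
  let ?q = "\<lambda>m k. complex_of_real (1 / (e m + e k)) *\<^sub>C (g m - g k)"
  have "\<exists>C. \<forall>x \<in> range (\<lambda>(m, k). ?q m k). norm_on ip x \<le> C"
  proof (rule uniform_boundedness)
    show "range (\<lambda>(m, k). ?q m k) \<subseteq> H"
      using g diff_in scaleC_in by auto
    fix f assume f: "f \<in> H"
    obtain C where C: "\<And>m. cmod (ip f (g m) - L f) \<le> C * e m"
      using L[OF f] by blast
    have "cmod (ip f (?q m k)) \<le> C" for m k
    proof -
      have pos: "0 < e m + e k" using e(1)[of m] e(1)[of k] by simp
      have "cmod (ip f (g m - g k)) \<le> C * (e m + e k)"
        using C[of m] C[of k] norm_triangle_ineq4[of "ip f (g m) - L f" "ip f (g k) - L f"]
        by (simp add: ip_diff_right f g algebra_simps)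
      then show ?thesis
        using pos f g by (simp add: ip_scaleC_right diff_in norm_mult norm_divide divide_le_eq
            flip: of_real_add)
    qed
    then show "\<exists>C. \<forall>x \<in> range (\<lambda>(m, k). ?q m k). cmod (ip f x) \<le> C"
      by auto
  qed
  then obtain C where C: "\<And>m k. norm_on ip (?q m k) \<le> C"
    by auto
  have bd: "norm_on ip (g m - g k) \<le> \<bar>C\<bar> * (e m + e k)" for m k
  proof -
    have pos: "0 < e m + e k" using e(1)[of m] e(1)[of k] by simp
    have "norm_on ip (g m - g k) \<le> C * (e m + e k)"
      using C[of m k] pos g by (simp add: norm_on_scaleC diff_in norm_divide divide_le_eq
          flip: of_real_add)
    also have "\<dots> \<le> \<bar>C\<bar> * (e m + e k)"
      using pos by (intro mult_right_mono) auto
    finally show ?thesis .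
  qed
  have "\<exists>c\<in>H. (\<lambda>n. norm_on ip (g n - c)) \<longlonglongrightarrow> 0"
  proof (rule complete[OF g])
    fix d :: real assume "0 < d"
    \<comment> \<open>Adding 1 makes the constant strictly positive, so that it can be divided
      by.\<close>
    define k where "k = \<bar>C\<bar> + 1"
    have k: "0 < k" by (simp add: k_def)
    then have "0 < d / (2 * k)" using \<open>0 < d\<close> by simp
    then obtain N where N: "\<And>n. N \<le> n \<Longrightarrow> e n < d / (2 * k)"
      using LIMSEQ_D[OF e(2)] by fastforce
    have "norm_on ip (g m - g n) < d" if "N \<le> m" "N \<le> n" for m n
    proof -
      have "norm_on ip (g m - g n) \<le> \<bar>C\<bar> * (e m + e n)" by (rule bd)
      also have "\<dots> \<le> k * (e m + e n)"
        using e(1)[of m] e(1)[of n] by (intro mult_right_mono) (auto simp: k_def)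
      also have "\<dots> < k * (d / (2 * k) + d / (2 * k))"
        using N[OF that(1)] N[OF that(2)] k by (intro mult_strict_left_mono add_strict_mono) auto
      also have "\<dots> = d" using k by (simp add: field_simps)
      finally show ?thesis .
    qed
    then show "\<exists>N. \<forall>m\<ge>N. \<forall>n\<ge>N. norm_on ip (g m - g n) < d" by blast
  qed
  then obtain c where c: "c \<in> H" and lim: "(\<lambda>n. norm_on ip (g n - c)) \<longlonglongrightarrow> 0" by blast
  have "ip f c = L f" if f: "f \<in> H" for f
  proof -
    obtain B where B: "\<And>m. cmod (ip f (g m) - L f) \<le> B * e m"
      using L[OF f] by blast
    have "(\<lambda>m. ip f (g m) - L f) \<longlonglongrightarrow> 0"
      by (rule Lim_null_comparison[OF _ tendsto_mult_right_zero[OF e(2), of B]]) (use B in simp)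
    then have "(\<lambda>m. ip f (g m)) \<longlonglongrightarrow> L f" by (simp add: LIM_zero_iff)
    then show ?thesis
      using ip_tendsto_right[OF g c f lim] LIMSEQ_unique by blast
  qed
  then show ?thesis using c by blast
qed

end

section \<open>The inner product of the coefficient space\<close>

lemma norm_on_cinner: "norm_on cinner (x::'e::complex_hilbert) = norm x"
  by (simp add: norm_on_def cinner_self)

text \<open>The coefficient space is treated as a carrier-based Hilbert space with carrier
  \<open>UNIV\<close>, so that Cauchy-Schwarz and the extensionality lemma above apply to it as
  well.\<close>

interpretation cinner: hilbert_space_on "UNIV :: 'e::complex_hilbert set" cinner
proof
  show "complex_vector.subspace (UNIV :: 'e set)" by simp
  fix X :: "nat \<Rightarrow> 'e"
  assume "\<And>e. 0 < e \<Longrightarrow> \<exists>N. \<forall>m\<ge>N. \<forall>n\<ge>N. norm_on cinner (X m - X n) < e"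
  then have "Cauchy X"
    unfolding norm_on_cinner by (intro CauchyI) auto
  then obtain L where "X \<longlonglongrightarrow> L" using Cauchy_convergent_iff convergent_def by blast
  then have "(\<lambda>n. norm (X n - L)) \<longlonglongrightarrow> 0"
    by (simp add: LIM_zero tendsto_norm_zero)
  then show "\<exists>f\<in>UNIV. (\<lambda>n. norm_on cinner (X n - f)) \<longlonglongrightarrow> 0"
    unfolding norm_on_cinner by blast
qed (auto simp: cinner_add_left cinner_scaleC_left cinner_self intro: cinner_commute)

lemma bounded_linear_cinner_left: "bounded_linear (\<lambda>x. cinner x (y::'e::complex_hilbert))"
  using cinner.Cauchy_Schwarz[of _ y]
  by (intro bounded_linear_intro[where K = "norm y"])
     (simp_all add: cinner_add_left cinner_scaleC_left scaleR_scaleC norm_on_cinner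
       scaleR_conv_of_real)

text \<open>Test with \<open>y = x\<close> and divide by \<open>norm x\<close>.\<close>

lemma norm_le_of_cinner_le:
  assumes "\<And>y::'e::complex_hilbert. cmod (cinner x y) \<le> C * norm y" "0 \<le> C"
  shows "norm x \<le> C"
proof (cases "x = 0")
  case False
  have "norm x * norm x \<le> C * norm x"
    using assms(1)[of x] by (simp add: cinner_self norm_mult norm_power power2_eq_square)
  then show ?thesis using False by simp
qed (use assms in simp)

lemma analytic_vec_on_imp_holomorphic_cinner:
  fixes f :: "complex \<Rightarrow> 'e::complex_hilbert"
  assumes "analytic_vec_on f S"
  shows "(\<lambda>w. cinner (f w) \<eta>) holomorphic_on S"
proof -
  have "open S" using assms by (simp add: analytic_vec_on_def)
  moreover have "\<exists>d. ((\<lambda>w. cinner (f w) \<eta>) has_field_derivative d) (at z)" if "z \<in> S" for z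
  proof -
    obtain D where "(f has_derivative (\<lambda>h. h *\<^sub>C D)) (at z)"
      using assms \<open>z \<in> S\<close> unfolding analytic_vec_on_def by blast
    from bounded_linear.has_derivative[OF bounded_linear_cinner_left this]
    have "((\<lambda>w. cinner (f w) \<eta>) has_derivative (\<lambda>h. cinner D \<eta> * h)) (at z)"
      by (simp add: cinner_scaleC_left mult.commute)
    then show ?thesis by (auto simp: has_field_derivative_def)
  qed
  ultimately show ?thesis by (simp add: holomorphic_on_open)
qed


section \<open>Higher derivatives and Cauchy estimates of scalar functions\<close>

text \<open>Conjugating both argument and value preserves holomorphy and conjugates the derivative.
  This is used to pass from antiholomorphic dependence on the second kernel variable to ordinary
  Taylor coefficients.\<close>

lemma higher_deriv_cnj_cnj:
  assumes f: "f holomorphic_on cnj ` S" and S: "open S" and w: "w \<in> S"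
  shows "(deriv ^^ n) (\<lambda>w. cnj (f (cnj w))) w = cnj ((deriv ^^ n) f (cnj w))"
  using w
proof (induction n arbitrary: w)
  case (Suc n)
  have cS: "open (cnj ` S)"
    unfolding image_cnj_conv_vimage_cnj using S by (intro open_vimage continuous_intros)
  have hol: "(\<lambda>w. cnj (g (cnj w))) holomorphic_on S" if "g holomorphic_on cnj ` S" for g
    using holomorphic_on_compose_cnj_cnj[OF that S] by (simp add: o_def)
  have "deriv ((deriv ^^ n) (\<lambda>w. cnj (f (cnj w)))) w
      = deriv (\<lambda>w. cnj ((deriv ^^ n) f (cnj w))) w"
    by (rule complex_derivative_transform_within_open[OF _ _ S Suc.prems])
       (auto intro!: holomorphic_higher_deriv hol f cS S simp: Suc.IH)
  also have "\<dots> = cnj ((deriv ^^ Suc n) f (cnj w))"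
  proof (rule DERIV_imp_deriv)
    have "((deriv ^^ n) f has_field_derivative (deriv ^^ Suc n) f (cnj w)) (at (cnj w))"
      using Suc.prems by (intro has_field_derivative_higher_deriv[OF f cS]) auto
    then show "((\<lambda>w. cnj ((deriv ^^ n) f (cnj w))) has_field_derivative
        cnj ((deriv ^^ Suc n) f (cnj w))) (at w)"
      using has_field_derivative_cnj_cnj by (fastforce simp: o_def)
  qed
  finally show ?case by simp
qed simp

text \<open>In Leibniz's rule at 0 the identity contributes only through its first derivative. For
  \<open>n = 0\<close> the truncated \<open>n - 1\<close> is harmless because the factor
  \<open>of_nat n\<close> vanishes.\<close>

lemma higher_deriv_ident_mult_0:
  assumes f: "f holomorphic_on S" and S: "open S" "0 \<in> S"
  shows "(deriv ^^ n) (\<lambda>w. w * f w) 0 = of_nat n * (deriv ^^ (n - 1)) f 0"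
proof -
  have "(deriv ^^ n) (\<lambda>w. w * f w) 0
      = (\<Sum>i = 0..n. of_nat (n choose i) * (deriv ^^ i) (\<lambda>w. w) 0 * (deriv ^^ (n - i)) f 0)"
    by (rule higher_deriv_mult[OF holomorphic_on_ident f S])
  also have "\<dots> = (\<Sum>i = 0..n. if i = 1 then of_nat n * (deriv ^^ (n - 1)) f 0 else 0)"
    by (intro sum.cong) auto
  finally show ?thesis by (cases n) simp_all
qed

text \<open>Cauchy's inequality on circles inside \<open>cball 0 s\<close>. The constants depend on
  \<open>f\<close> only through \<open>B\<close>, so the estimates are uniform over families of
  functions with a common bound.\<close>

lemma holomorphic_disc_bounds:
  assumes f: "f holomorphic_on disc" and B: "\<And>z. cmod z \<le> s \<Longrightarrow> cmod (f z) \<le> B"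
    and s: "s < 1" and w: "cmod w + r \<le> s" and r: "0 < r"
  shows cmod_deriv_le: "cmod (deriv f w) \<le> B / r"
    and cmod_remainder_le: "cmod h \<le> r / 2 \<Longrightarrow>
      cmod (f (w + h) - f w - h * deriv f w) \<le> 8 * B / r\<^sup>2 * (cmod h)\<^sup>2"
proof -
  have higher: "cmod ((deriv ^^ n) f u) \<le> fact n * B / d ^ n"
    if d: "0 < d" "cmod u + d \<le> s" for n u d
  proof (rule Cauchy_inequality)
    have sub: "cball u d \<subseteq> disc"
    proof
      fix x assume "x \<in> cball u d"
      then show "x \<in> disc"
        using norm_triangle_ineq3[of x u] d s by (auto simp: dist_norm norm_minus_commute)
    qed
    then show "f holomorphic_on ball u d"
      using f ball_subset_cball holomorphic_on_subset by blast
    show "continuous_on (cball u d) f"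
      using f sub holomorphic_on_imp_continuous_on continuous_on_subset by blast
    show "cmod (f x) \<le> B" if "cmod (u - x) = d" for x
      using B[of x] norm_triangle_ineq3[of x u] d that by (auto simp: norm_minus_commute)
  qed (use d in auto)
  show "cmod (deriv f w) \<le> B / r"
    using higher[of r w 1] r w by simp
  assume h: "cmod h \<le> r / 2"
  \<comment> \<open>Halving the radius leaves a circle of radius \<open>r / 2\<close> around every
    point of \<open>?S\<close> inside \<open>cball 0 s\<close>. Cauchy's inequality for the second
    derivative then gives \<open>2 * B / (r / 2)\<^sup>2\<close>, which is the constant
    \<open>8 * B / r\<^sup>2\<close>.\<close>
  let ?S = "cball w (r / 2)"
  have S: "cmod u + r / 2 \<le> s" if "u \<in> ?S" for u
    using that norm_triangle_ineq3[of u w] w r by (auto simp: dist_norm norm_minus_commute)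
  have "cmod ((deriv ^^ 0) f (w + h) - (\<Sum>i\<le>1. (deriv ^^ i) f w * (w + h - w) ^ i / fact i))
      \<le> 8 * B / r\<^sup>2 * cmod (w + h - w) ^ Suc 1 / fact 1"
  proof (rule complex_Taylor)
    show "convex ?S" by simp
    show "w \<in> ?S" "w + h \<in> ?S" using r h by (auto simp: dist_norm)
    fix x assume x: "x \<in> ?S"
    then have "x \<in> disc" using S[OF x] r s by simp
    then show "((deriv ^^ i) f has_field_derivative (deriv ^^ Suc i) f x) (at x within ?S)" for i
      using has_field_derivative_higher_deriv[OF f] by (blast intro: has_field_derivative_at_within)
    show "cmod ((deriv ^^ Suc 1) f x) \<le> 8 * B / r\<^sup>2"
      using higher[of "r / 2" x 2] r S[OF x] by (simp add: numeral_2_eq_2 power2_eq_square)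
  qed
  then show "cmod (f (w + h) - f w - h * deriv f w) \<le> 8 * B / r\<^sup>2 * (cmod h)\<^sup>2"
    by (simp add: power2_eq_square algebra_simps)
qed

section \<open>Operator-valued functions holomorphic in the weak sense\<close>

lemma norm_blinfun_le_of_cinner_le:
  fixes T :: "'e::complex_hilbert \<Rightarrow>\<^sub>L 'e"
  assumes "\<And>\<eta> \<zeta>. cmod (cinner (T \<eta>) \<zeta>) \<le> C * norm \<eta> * norm \<zeta>" "0 \<le> C"
  shows "norm T \<le> C"
  using assms by (intro norm_blinfun_bound norm_le_of_cinner_le) auto

lemma norm_cinner_blinfun_le:
  fixes T :: "'e::complex_hilbert \<Rightarrow>\<^sub>L 'e"
  shows "cmod (cinner (T \<eta>) \<zeta>) \<le> norm T * norm \<eta> * norm \<zeta>"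
proof -
  have "cmod (cinner (T \<eta>) \<zeta>) \<le> norm (T \<eta>) * norm \<zeta>"
    using cinner.Cauchy_Schwarz by (auto simp: norm_on_cinner)
  also have "\<dots> \<le> norm T * norm \<eta> * norm \<zeta>"
    by (intro mult_right_mono norm_blinfun) auto
  finally show ?thesis .
qed

lemma bounded_linear_scaleC_left: "bounded_linear (\<lambda>a. a *\<^sub>C (x :: 'a::complex_normed_vector))"
  by (rule bounded_linear_intro[where K = "norm x"])
     (simp_all add: scaleC_add_left scaleR_scaleC scaleC_scaleC norm_scaleC scaleR_conv_of_real)

lemma cinner_minus_left: "cinner (x - y) z = cinner x z - cinner y (z::'e::complex_hilbert)"
  by (simp add: cinner.ip_diff_left)

text \<open>The second clause bounds all the scalar functions on a smaller disc by a common constant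
  times \<open>norm \<eta> * norm \<zeta>\<close>, the form in which scalar Cauchy estimates become
  operator norm estimates.\<close>

definition weakly_holomorphic :: "(complex \<Rightarrow> 'e::complex_hilbert \<Rightarrow>\<^sub>L 'e) \<Rightarrow> bool" where
  "weakly_holomorphic G \<longleftrightarrow>
     (\<forall>\<eta> \<zeta>. (\<lambda>w. cinner (G w \<eta>) \<zeta>) holomorphic_on disc) \<and>
     (\<forall>r<1. \<exists>M. \<forall>w\<in>cball 0 r. norm (G w) \<le> M)"

text \<open>The Cauchy estimates for the scalar functions are uniform over the unit balls, so the
  difference quotients converge in operator norm.\<close>

lemma weakly_holomorphic_has_derivative:
  fixes G :: "complex \<Rightarrow> 'e::complex_hilbert \<Rightarrow>\<^sub>L 'e"
  assumes G: "weakly_holomorphic G" and w: "w \<in> disc"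
  shows "\<exists>D. (G has_derivative (\<lambda>h. h *\<^sub>C D)) (at w) \<and>
    (\<forall>\<eta> \<zeta>. cinner (D \<eta>) \<zeta> = deriv (\<lambda>w. cinner (G w \<eta>) \<zeta>) w)"
proof -
  \<comment> \<open>\<open>s\<close> is the radius halfway between \<open>cmod w\<close> and 1, and
    \<open>r\<close> is the remaining gap, so that \<open>cmod w + r\<close> equals
    \<open>s\<close>.\<close>
  define s where "s = (1 + cmod w) / 2"
  define r where "r = (1 - cmod w) / 2"
  have sr: "s < 1" "0 < r" "cmod w + r \<le> s"
    using w by (auto simp: s_def r_def field_simps)
  obtain M where M: "\<And>z. cmod z \<le> s \<Longrightarrow> norm (G z) \<le> M"
    using G sr(1) unfolding weakly_holomorphic_def by (metis dist_0_norm mem_cball)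
  define \<phi> where "\<phi> = (\<lambda>\<eta> \<zeta> z. cinner (G z \<eta>) \<zeta>)"
  have hol: "\<phi> \<eta> \<zeta> holomorphic_on disc" for \<eta> \<zeta>
    using G by (simp add: weakly_holomorphic_def \<phi>_def)
  have bd: "cmod (\<phi> \<eta> \<zeta> z) \<le> M * norm \<eta> * norm \<zeta>" if "cmod z \<le> s" for \<eta> \<zeta> z
    unfolding \<phi>_def using M[OF that] norm_cinner_blinfun_le[of "G z" \<eta> \<zeta>]
    by (meson mult_right_mono norm_ge_zero order_trans)
  define K where "K = 8 * M / r\<^sup>2"
  have "0 \<le> M" using order_trans[OF norm_ge_zero M[of w]] sr by simp
  then have K: "0 \<le> K" by (simp add: K_def)
  have rem: "cmod (cinner ((G (w + h) - G w) \<eta>) \<zeta> - h * deriv (\<phi> \<eta> \<zeta>) w)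
      \<le> K * (cmod h)\<^sup>2 * norm \<eta> * norm \<zeta>" if "cmod h \<le> r / 2" for h \<eta> \<zeta>
    using cmod_remainder_le[OF hol bd sr(1,3,2) that, of \<eta> \<zeta>]
    by (simp add: \<phi>_def K_def blinfun.diff_left cinner_minus_left mult_ac)
  define Q where "Q = (\<lambda>h. inverse h *\<^sub>C (G (w + h) - G w))"
  have Q: "cmod (cinner (Q h \<eta>) \<zeta> - deriv (\<phi> \<eta> \<zeta>) w) \<le> K * cmod h * norm \<eta> * norm \<zeta>"
    if h: "cmod h \<le> r / 2" "h \<noteq> 0" for h \<eta> \<zeta>
  proof -
    have "cinner (Q h \<eta>) \<zeta> - deriv (\<phi> \<eta> \<zeta>) w
        = inverse h * (cinner ((G (w + h) - G w) \<eta>) \<zeta> - h * deriv (\<phi> \<eta> \<zeta>) w)"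
      using h(2) by (simp add: Q_def scaleC_blinfun.rep_eq cinner_scaleC_left right_diff_distrib)
    then have "cmod (cinner (Q h \<eta>) \<zeta> - deriv (\<phi> \<eta> \<zeta>) w)
        \<le> inverse (cmod h) * (K * (cmod h)\<^sup>2 * norm \<eta> * norm \<zeta>)"
      using rem[OF h(1), of \<eta> \<zeta>] by (simp add: norm_mult norm_inverse mult_left_mono)
    also have "\<dots> = K * cmod h * norm \<eta> * norm \<zeta>"
      using h(2) by (simp add: power2_eq_square field_simps)
    finally show ?thesis .
  qed
  \<comment> \<open>The candidate \<open>D\<close> is found along one sequence of increments, using
    completeness of the operator space. The estimate \<open>rem\<close>, valid for all small
    increments, then shows that \<open>D\<close> is the full derivative.\<close>
  define h where "h = (\<lambda>m::nat. complex_of_real (r / 2 * inverse (real (Suc m))))"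
  have hm: "cmod (h m) = r / 2 * inverse (real (Suc m))" for m
    unfolding h_def norm_of_real using sr(2) by simp
  have h: "cmod (h m) \<le> r / 2" "h m \<noteq> 0" for m
    using sr(2) hm[of m] by (auto simp: field_simps)
  have h0: "(\<lambda>m. cmod (h m)) \<longlonglongrightarrow> 0"
    unfolding hm by (rule tendsto_mult_right_zero[OF LIMSEQ_inverse_real_of_nat])
  have QQ: "norm (Q (h m) - Q (h n)) \<le> K * (cmod (h m) + cmod (h n))" for m n
  proof (rule norm_blinfun_le_of_cinner_le)
    fix \<eta> \<zeta> :: 'e
    have "cinner ((Q (h m) - Q (h n)) \<eta>) \<zeta> = (cinner (Q (h m) \<eta>) \<zeta> - deriv (\<phi> \<eta> \<zeta>) w)
        - (cinner (Q (h n) \<eta>) \<zeta> - deriv (\<phi> \<eta> \<zeta>) w)"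
      by (simp add: blinfun.diff_left cinner_minus_left)
    then have "cmod (cinner ((Q (h m) - Q (h n)) \<eta>) \<zeta>)
        \<le> K * cmod (h m) * norm \<eta> * norm \<zeta> + K * cmod (h n) * norm \<eta> * norm \<zeta>"
      using Q[OF h, of m \<eta> \<zeta>] Q[OF h, of n \<eta> \<zeta>] norm_triangle_le_diff add_mono by metis
    then show "cmod (cinner ((Q (h m) - Q (h n)) \<eta>) \<zeta>)
        \<le> K * (cmod (h m) + cmod (h n)) * norm \<eta> * norm \<zeta>"
      by (simp add: algebra_simps)
  qed (use K in simp)
  have "Cauchy (\<lambda>m. Q (h m))"
  proof (rule CauchyI)
    fix e :: real assume "0 < e"
    define k where "k = K + 1"
    have k: "0 < k" using K by (simp add: k_def)
    then have "0 < e / (2 * k)" using \<open>0 < e\<close> by simp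
    then obtain N where N: "\<And>n. N \<le> n \<Longrightarrow> cmod (h n) < e / (2 * k)"
      using LIMSEQ_D[OF h0] by fastforce
    have "norm (Q (h m) - Q (h n)) < e" if "N \<le> m" "N \<le> n" for m n
    proof -
      have "norm (Q (h m) - Q (h n)) \<le> k * (cmod (h m) + cmod (h n))"
        by (rule order_trans[OF QQ]) (simp add: k_def mult_right_mono)
      also have "\<dots> < k * (e / (2 * k) + e / (2 * k))"
        using N[OF that(1)] N[OF that(2)] k by (intro mult_strict_left_mono add_strict_mono) auto
      also have "\<dots> = e" using k by (simp add: field_simps)
      finally show ?thesis .
    qed
    then show "\<exists>N. \<forall>m\<ge>N. \<forall>n\<ge>N. norm (Q (h m) - Q (h n)) < e" by blast
  qed
  then obtain D where D: "(\<lambda>m. Q (h m)) \<longlonglongrightarrow> D"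
    using Cauchy_convergent_iff convergent_def by blast
  have cD: "cinner (D \<eta>) \<zeta> = deriv (\<phi> \<eta> \<zeta>) w" for \<eta> \<zeta>
  proof (rule LIMSEQ_unique)
    show "(\<lambda>m. cinner (Q (h m) \<eta>) \<zeta>) \<longlonglongrightarrow> cinner (D \<eta>) \<zeta>"
      by (intro bounded_linear.tendsto[OF bounded_linear_cinner_left] tendsto_intros D)
    have "(\<lambda>m. cinner (Q (h m) \<eta>) \<zeta> - deriv (\<phi> \<eta> \<zeta>) w) \<longlonglongrightarrow> 0"
    proof (rule Lim_null_comparison)
      show "\<forall>\<^sub>F m in sequentially. cmod (cinner (Q (h m) \<eta>) \<zeta> - deriv (\<phi> \<eta> \<zeta>) w)
          \<le> K * norm \<eta> * norm \<zeta> * cmod (h m)"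
        using Q[OF h] by (simp add: mult_ac)
    qed (rule tendsto_mult_right_zero[OF h0])
    then show "(\<lambda>m. cinner (Q (h m) \<eta>) \<zeta>) \<longlonglongrightarrow> deriv (\<phi> \<eta> \<zeta>) w"
      by (simp add: LIM_zero_iff)
  qed
  \<comment> \<open>The pairings of \<open>D\<close> are the scalar derivatives, so
    \<open>rem\<close> bounds every pairing of the remainder and hence its operator norm. The bound
    is quadratic, so dividing by \<open>norm k\<close> leaves a null quantity.\<close>
  have quad: "norm (G (w + k) - G w - k *\<^sub>C D) \<le> K * (cmod k)\<^sup>2" if "cmod k \<le> r / 2" for k
  proof (rule norm_blinfun_le_of_cinner_le)
    show "cmod (cinner ((G (w + k) - G w - k *\<^sub>C D) \<eta>) \<zeta>) \<le> K * (cmod k)\<^sup>2 * norm \<eta> * norm \<zeta>"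
      for \<eta> \<zeta>
      using rem[OF that, of \<eta> \<zeta>]
      by (simp add: blinfun.diff_left scaleC_blinfun.rep_eq cinner_minus_left cinner_scaleC_left cD)
  qed (use K in simp)
  have "(G has_derivative (\<lambda>h. h *\<^sub>C D)) (at w)"
    unfolding has_derivative_at
  proof
    show "(\<lambda>k. norm (G (w + k) - G w - k *\<^sub>C D) / norm k) \<midarrow>0\<rightarrow> 0"
    proof (rule Lim_null_comparison)
      have "norm (G (w + k) - G w - k *\<^sub>C D) / norm k \<le> K * norm k"
        if "k \<noteq> 0" "dist k 0 < r / 2" for k
        using quad[of k] that by (simp add: divide_le_eq power2_eq_square mult_ac)
      then show "\<forall>\<^sub>F k in at 0. norm (norm (G (w + k) - G w - k *\<^sub>C D) / norm k) \<le> K * norm k"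
        unfolding eventually_at using sr(2) by (intro exI[of _ "r / 2"]) auto
      show "((\<lambda>k. K * norm k) \<longlongrightarrow> 0) (at (0::complex))"
        by (intro tendsto_mult_right_zero tendsto_norm_zero tendsto_ident_at)
    qed
  qed (rule bounded_linear_scaleC_left)
  then show ?thesis using cD by (auto simp: \<phi>_def)
qed

text \<open>Local boundedness survives differentiation by Cauchy's estimate on a slightly larger
  disc, so differentiation in operator norm can be iterated.\<close>

lemma weakly_holomorphic_derivative:
  fixes G D :: "complex \<Rightarrow> 'e::complex_hilbert \<Rightarrow>\<^sub>L 'e"
  assumes G: "weakly_holomorphic G"
    and D: "\<And>w \<eta> \<zeta>. w \<in> disc \<Longrightarrow> cinner (D w \<eta>) \<zeta> = deriv (\<lambda>w. cinner (G w \<eta>) \<zeta>) w"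
  shows "weakly_holomorphic D"
  unfolding weakly_holomorphic_def
proof (intro conjI allI impI)
  have hol: "(\<lambda>w. cinner (G w \<eta>) \<zeta>) holomorphic_on disc" for \<eta> \<zeta>
    using G by (simp add: weakly_holomorphic_def)
  show "(\<lambda>w. cinner (D w \<eta>) \<zeta>) holomorphic_on disc" for \<eta> \<zeta>
    using holomorphic_deriv[OF hol] by (rule holomorphic_transform) (simp_all add: D)
  fix r :: real assume r: "r < 1"
  \<comment> \<open>The bound \<open>r\<close> may be negative; \<open>max r 0\<close> keeps
    \<open>s\<close> between 0 and 1.\<close>
  define s where "s = (1 + max r 0) / 2"
  have s: "s < 1" "0 < s - max r 0" using r by (auto simp: s_def max_def)
  obtain M where M: "\<And>z. cmod z \<le> s \<Longrightarrow> norm (G z) \<le> M"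
    using G s(1) unfolding weakly_holomorphic_def by (metis dist_0_norm mem_cball)
  have M0: "0 \<le> M" using order_trans[OF norm_ge_zero M[of 0]] s by (simp add: s_def)
  have "norm (D w) \<le> M / (s - max r 0)" if "w \<in> cball 0 r" for w
  proof (rule norm_blinfun_le_of_cinner_le)
    fix \<eta> \<zeta> :: 'e
    have w: "cmod w + (s - max r 0) \<le> s" "w \<in> disc" using that r by auto
    have bd: "cmod (cinner (G z \<eta>) \<zeta>) \<le> M * norm \<eta> * norm \<zeta>" if "cmod z \<le> s" for z
      using M[OF that] norm_cinner_blinfun_le[of "G z" \<eta> \<zeta>]
      by (meson mult_right_mono norm_ge_zero order_trans)
    show "cmod (cinner (D w \<eta>) \<zeta>) \<le> M / (s - max r 0) * norm \<eta> * norm \<zeta>"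
      using cmod_deriv_le[OF hol bd s(1) w(1) s(2)] by (simp add: D[OF w(2)])
  qed (use M0 s in simp)
  then show "\<exists>M. \<forall>w\<in>cball 0 r. norm (D w) \<le> M" by blast
qed

text \<open>An antilinear derivative takes the values \<open>D\<close> at 1 and
  \<open>- \<i> *\<^sub>C D\<close> at \<open>\<i>\<close>, so both terms of
  \<open>deriv_cnj\<close> contribute half of \<open>D\<close>.\<close>

lemma deriv_cnj_eq:
  assumes "(f has_derivative (\<lambda>h. cnj h *\<^sub>C D)) (at w)"
  shows "deriv_cnj f w = D"
proof -
  have "\<i> *\<^sub>C cnj \<i> *\<^sub>C D = D" by (simp add: scaleC_scaleC scaleC_one)
  moreover have "D + D = 2 *\<^sub>C D"
    using scaleC_add_left[of 1 1 D] by (simp add: scaleC_one)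
  ultimately show ?thesis
    unfolding deriv_cnj_def frechet_derivative_at[OF assms, symmetric]
    by (simp add: scaleC_scaleC scaleC_one)
qed

lemma cinner_higher_deriv_cnj:
  fixes F :: "complex \<Rightarrow> 'e::complex_hilbert \<Rightarrow>\<^sub>L 'e"
  assumes F: "weakly_holomorphic (\<lambda>w. F (cnj w))"
  shows "cinner ((deriv_cnj ^^ n) F 0 \<eta>) \<zeta> = (deriv ^^ n) (\<lambda>w. cinner (F (cnj w) \<eta>) \<zeta>) 0"
proof -
  \<comment> \<open>Dependent choice builds all complex derivatives of \<open>F (cnj w)\<close> at
    once, each supplied only existentially; the clause for \<open>n = 0\<close> fixes the starting
    function.\<close>
  have "\<exists>D :: nat \<Rightarrow> complex \<Rightarrow> 'e \<Rightarrow>\<^sub>L 'e. \<forall>n.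
      (weakly_holomorphic (D n) \<and> (n = 0 \<longrightarrow> D n = (\<lambda>w. F (cnj w)))) \<and>
      (\<forall>w\<in>disc. (D n has_derivative (\<lambda>h. h *\<^sub>C D (Suc n) w)) (at w) \<and>
        (\<forall>\<eta> \<zeta>. cinner (D (Suc n) w \<eta>) \<zeta> = deriv (\<lambda>w. cinner (D n w \<eta>) \<zeta>) w))"
  proof (rule dependent_nat_choice)
    show "\<exists>G. weakly_holomorphic G \<and> (0 = (0::nat) \<longrightarrow> G = (\<lambda>w. F (cnj w)))"
      using F by blast
    fix G :: "complex \<Rightarrow> 'e \<Rightarrow>\<^sub>L 'e" and n :: nat
    assume "weakly_holomorphic G \<and> (n = 0 \<longrightarrow> G = (\<lambda>w. F (cnj w)))"
    then have G: "weakly_holomorphic G" by blast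
    obtain D :: "complex \<Rightarrow> 'e \<Rightarrow>\<^sub>L 'e"
      where D: "\<And>w. w \<in> disc \<Longrightarrow> (G has_derivative (\<lambda>h. h *\<^sub>C D w)) (at w)"
        "\<And>w \<eta> \<zeta>. w \<in> disc \<Longrightarrow> cinner (D w \<eta>) \<zeta> = deriv (\<lambda>w. cinner (G w \<eta>) \<zeta>) w"
      using weakly_holomorphic_has_derivative[OF G] by metis
    then show "\<exists>D :: complex \<Rightarrow> 'e \<Rightarrow>\<^sub>L 'e.
        (weakly_holomorphic D \<and> (Suc n = 0 \<longrightarrow> D = (\<lambda>w. F (cnj w)))) \<and>
        (\<forall>w\<in>disc. (G has_derivative (\<lambda>h. h *\<^sub>C D w)) (at w) \<and>
          (\<forall>\<eta> \<zeta>. cinner (D w \<eta>) \<zeta> = deriv (\<lambda>w. cinner (G w \<eta>) \<zeta>) w))"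
      using weakly_holomorphic_derivative[OF G D(2)] by blast
  qed
  then obtain D :: "nat \<Rightarrow> complex \<Rightarrow> 'e \<Rightarrow>\<^sub>L 'e"
    where wh: "\<And>n. weakly_holomorphic (D n)" and D0: "D 0 = (\<lambda>w. F (cnj w))"
    and D: "\<And>n w. w \<in> disc \<Longrightarrow> (D n has_derivative (\<lambda>h. h *\<^sub>C D (Suc n) w)) (at w)"
    and cD: "\<And>n w \<eta> \<zeta>. w \<in> disc \<Longrightarrow>
      cinner (D (Suc n) w \<eta>) \<zeta> = deriv (\<lambda>w. cinner (D n w \<eta>) \<zeta>) w"
    by metis
  \<comment> \<open>The claim is made on the whole disc because differentiating it once more
    requires equality near the point, not only at it.\<close>
  have dF: "(deriv_cnj ^^ n) F w = D n (cnj w)" if "w \<in> disc" for w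
    using that
  proof (induction n arbitrary: w)
    case 0
    then show ?case by (simp add: D0)
  next
    case (Suc n)
    have "((\<lambda>w. D n (cnj w)) has_derivative (\<lambda>h. cnj h *\<^sub>C D (Suc n) (cnj w))) (at w)"
      using Suc.prems
      by (intro has_derivative_compose[OF
            bounded_linear_imp_has_derivative[OF bounded_linear_cnj] D]) simp
    then have "((deriv_cnj ^^ n) F has_derivative (\<lambda>h. cnj h *\<^sub>C D (Suc n) (cnj w))) (at w)"
      by (rule has_derivative_transform_within_open[where s = disc]) (use Suc in auto)
    then show ?case using deriv_cnj_eq by simp
  qed
  have "cinner (D n w \<eta>) \<zeta> = (deriv ^^ n) (\<lambda>w. cinner (F (cnj w) \<eta>) \<zeta>) w" if "w \<in> disc" for w
    using that
  proof (induction n arbitrary: w)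
    case 0
    then show ?case by (simp add: D0)
  next
    case (Suc n)
    have "deriv (\<lambda>w. cinner (D n w \<eta>) \<zeta>) w
        = deriv ((deriv ^^ n) (\<lambda>w. cinner (F (cnj w) \<eta>) \<zeta>)) w"
    proof (rule complex_derivative_transform_within_open)
      show "(\<lambda>w. cinner (D n w \<eta>) \<zeta>) holomorphic_on disc"
        using wh by (simp add: weakly_holomorphic_def)
      show "(deriv ^^ n) (\<lambda>w. cinner (F (cnj w) \<eta>) \<zeta>) holomorphic_on disc"
        using F by (intro holomorphic_higher_deriv) (auto simp: weakly_holomorphic_def)
    qed (use Suc in auto)
    then show ?case using cD[OF Suc.prems] by simp
  qed
  from this[of 0] dF[of 0] show ?thesis by simp
qed


section \<open>Taylor coefficients in the reproducing kernel space\<close>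

context analytic_rkhs
begin

text \<open>The vector representing the \<open>n\<close>-th Taylor coefficient is the limit, as \<open>w\<close> tends to 0 along
  the positive reals, of \<open>K(\<cdot>, w)\<eta>\<close> minus its Taylor polynomial of degree \<open>n - 1\<close>, divided
  by \<open>w^n\<close>.\<close>

lemma ex_taylor_coefficient_vector:
  "\<exists>c\<in>H. \<forall>f\<in>H. ip f c = (deriv ^^ n) (\<lambda>w. cinner (f w) \<eta>) 0 / fact n"
proof (induction n rule: less_induct)
  case (less n)
  define a where "a = (\<lambda>n f. (deriv ^^ n) (\<lambda>w. cinner (f w) \<eta>) 0 / fact n)"
  have "\<forall>j\<in>{..<n}. \<exists>c. c \<in> H \<and> (\<forall>f\<in>H. ip f c = a j f)"
    unfolding a_def using less by blast
  then obtain c where c: "\<And>j. j < n \<Longrightarrow> c j \<in> H" "\<And>j f. j < n \<Longrightarrow> f \<in> H \<Longrightarrow> ip f (c j) = a j f"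
    by (metis lessThan_iff)
  \<comment> \<open>The points \<open>t m\<close> also serve as the error rate in
    \<open>ex_representing_limit\<close>. Being real, they leave the coefficients unconjugated in
    the second argument of \<open>ip\<close>.\<close>
  define t where "t = (\<lambda>m. 1/2 * inverse (real (Suc m)))"
  have t: "0 < t m" "t m \<le> 1/2" for m by (auto simp: t_def field_simps)
  define g where "g = (\<lambda>m. complex_of_real (1 / t m ^ n) *\<^sub>C
      (kernel_fun K (t m) \<eta> - (\<Sum>j<n. complex_of_real (t m ^ j) *\<^sub>C c j)))"
  have tdisc: "complex_of_real (t m) \<in> disc" for m
    using t[of m] by simp
  have sumH: "(\<Sum>j<n. complex_of_real (t m ^ j) *\<^sub>C c j) \<in> H" for m
    using c by (intro sum_in scaleC_in) auto
  have "\<exists>c\<in>H. \<forall>f\<in>H. ip f c = a n f"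
  proof (rule ex_representing_limit)
    show "g m \<in> H" for m
      unfolding g_def by (intro scaleC_in diff_in sumH kernel_fun_in tdisc)
    show "0 < t m" for m by (rule t)
    show "t \<longlonglongrightarrow> 0"
      unfolding t_def by (rule tendsto_mult_right_zero[OF LIMSEQ_inverse_real_of_nat])
    fix f assume f: "f \<in> H"
    let ?\<phi> = "\<lambda>w. cinner (f w) \<eta>"
    let ?S = "cball 0 (1/2) :: complex set"
    have hol: "?\<phi> holomorphic_on disc"
      using analytic[OF f] by (rule analytic_vec_on_imp_holomorphic_cinner)
    have S: "?S \<subseteq> disc" by auto
    have "continuous_on ?S ((deriv ^^ Suc n) ?\<phi>)"
      using holomorphic_higher_deriv[OF hol] S holomorphic_on_imp_continuous_on
        continuous_on_subset open_ball by blast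
    then have "bounded ((deriv ^^ Suc n) ?\<phi> ` ?S)"
      by (intro compact_imp_bounded compact_continuous_image) auto
    then obtain B where B: "\<And>x. x \<in> ?S \<Longrightarrow> cmod ((deriv ^^ Suc n) ?\<phi> x) \<le> B"
      unfolding bounded_iff by blast
    \<comment> \<open>The Taylor remainder is of order \<open>t m ^ Suc n\<close>; division by
      \<open>t m ^ n\<close> leaves one factor \<open>t m\<close>.\<close>
    have "cmod (ip f (g m) - a n f) \<le> B / fact n * t m" for m
    proof -
      have tm: "complex_of_real (t m) \<in> ?S" using t[of m] by simp
      have "cmod ((deriv ^^ 0) ?\<phi> (t m) -
          (\<Sum>i\<le>n. (deriv ^^ i) ?\<phi> 0 * (complex_of_real (t m) - 0) ^ i / fact i))
          \<le> B * cmod (complex_of_real (t m) - 0) ^ Suc n / fact n"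
      proof (rule complex_Taylor[where S = ?S])
        show "((deriv ^^ i) ?\<phi> has_field_derivative (deriv ^^ Suc i) ?\<phi> x) (at x within ?S)"
          if "x \<in> ?S" for i x
          using has_field_derivative_higher_deriv[OF hol] S that
          by (blast intro: has_field_derivative_at_within)
      qed (use B tm in auto)
      also have "(\<Sum>i\<le>n. (deriv ^^ i) ?\<phi> 0 * (complex_of_real (t m) - 0) ^ i / fact i)
          = (\<Sum>i<n. t m ^ i * a i f) + t m ^ n * a n f"
        by (simp add: a_def mult.commute flip: lessThan_Suc_atMost)
      finally have *: "cmod (?\<phi> (t m) - (\<Sum>i<n. t m ^ i * a i f) - t m ^ n * a n f)
          \<le> B * t m ^ Suc n / fact n"
        using t[of m] by (simp add: diff_diff_eq)
      have "ip f (\<Sum>j<n. complex_of_real (t m ^ j) *\<^sub>C c j) = (\<Sum>i<n. t m ^ i * a i f)"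
        using f c by (subst ip_sum_right) (auto simp: ip_scaleC_right scaleC_in)
      then have "ip f (g m) = (?\<phi> (t m) - (\<Sum>i<n. t m ^ i * a i f)) / t m ^ n"
        using f c tdisc[of m] sumH[of m]
        by (simp add: g_def ip_scaleC_right ip_diff_right diff_in kernel_fun_in reproducing)
      then have "ip f (g m) - a n f
          = (?\<phi> (t m) - (\<Sum>i<n. t m ^ i * a i f) - t m ^ n * a n f) / t m ^ n"
        using t[of m] by (simp add: field_simps)
      then have "cmod (ip f (g m) - a n f)
          = cmod (?\<phi> (t m) - (\<Sum>i<n. t m ^ i * a i f) - t m ^ n * a n f) / t m ^ n"
        using t[of m] by (simp add: norm_divide norm_power)
      also have "\<dots> \<le> (B * t m ^ Suc n / fact n) / t m ^ n"
        using * t[of m] by (intro divide_right_mono) auto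
      also have "\<dots> = B / fact n * t m"
        using t[of m] by simp
      finally show ?thesis .
    qed
    then show "\<exists>C. \<forall>m. cmod (ip f (g m) - a n f) \<le> C * t m" by blast
  qed
  then show ?case by (simp add: a_def)
qed

text \<open>Evaluate the inner product of two kernel functions by the reproducing property in either
  order.\<close>

lemma kernel_adjoint:
  assumes z: "z \<in> disc" and w: "w \<in> disc"
  shows "cinner (K z w \<eta>) \<zeta> = cnj (cinner (K w z \<zeta>) \<eta>)"
proof -
  have "ip (kernel_fun K w \<eta>) (kernel_fun K z \<zeta>)
      = cnj (ip (kernel_fun K z \<zeta>) (kernel_fun K w \<eta>))"
    using z w by (intro ip_commute kernel_fun_in)
  then show ?thesis
    using z w by (simp add: reproducing kernel_fun_in) (simp add: kernel_fun_def on_disc_def)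
qed

text \<open>By the symmetry of the kernel, the pairings are conjugates of those of functions in
  \<open>H\<close>, which gives holomorphy. Operator norm continuity in the first variable bounds
  the kernel on compact discs, and symmetry carries this bound to the second variable.\<close>

lemma weakly_holomorphic_kernel:
  assumes K: "analytic_kernel K" and z: "z \<in> disc"
  shows "weakly_holomorphic (\<lambda>w. K z (cnj w))"
  unfolding weakly_holomorphic_def
proof (intro conjI allI impI)
  have cnj_disc: "cnj ` disc \<subseteq> disc" by auto
  fix \<eta> \<zeta>
  have "(\<lambda>w. cinner (kernel_fun K z \<zeta> w) \<eta>) holomorphic_on disc"
    using z by (intro analytic_vec_on_imp_holomorphic_cinner analytic kernel_fun_in)
  from holomorphic_on_compose_cnj_cnj[OF holomorphic_on_subset[OF this cnj_disc] open_ball]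
  show "(\<lambda>w. cinner (K z (cnj w) \<eta>) \<zeta>) holomorphic_on disc"
    by (rule holomorphic_transform)
       (use kernel_adjoint[OF z] in \<open>auto simp: kernel_fun_def on_disc_def\<close>)
next
  fix r :: real assume r: "r < 1"
  have "analytic_vec_on (\<lambda>w. K w z) disc"
    using K z by (simp add: analytic_kernel_def)
  then have "continuous_on disc (\<lambda>w. K w z)"
    unfolding analytic_vec_on_def
    by (metis continuous_at_imp_continuous_on has_derivative_continuous)
  then have "continuous_on (cball 0 r) (\<lambda>w. K w z)"
    by (rule continuous_on_subset) (use r in auto)
  then have "bounded ((\<lambda>w. K w z) ` cball 0 r)"
    by (intro compact_imp_bounded compact_continuous_image) auto
  then obtain M where M: "\<And>w. w \<in> cball 0 r \<Longrightarrow> norm (K w z) \<le> M"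
    unfolding bounded_iff by blast
  have le: "norm (K z (cnj w)) \<le> norm (K (cnj w) z)" if "w \<in> cball 0 r" for w
  proof (rule norm_blinfun_le_of_cinner_le)
    fix \<eta> \<zeta>
    have "cnj w \<in> disc" using that r by simp
    from kernel_adjoint[OF z this, of \<eta> \<zeta>]
    show "cmod (cinner (K z (cnj w) \<eta>) \<zeta>) \<le> norm (K (cnj w) z) * norm \<eta> * norm \<zeta>"
      using norm_cinner_blinfun_le[of "K (cnj w) z" \<zeta> \<eta>] by (simp add: mult_ac)
  qed simp
  have "norm (K z (cnj w)) \<le> M" if "w \<in> cball 0 r" for w
    using order_trans[OF le[OF that] M] that by simp
  then show "\<exists>M. \<forall>w\<in>cball 0 r. norm (K z (cnj w)) \<le> M" by blast
qed

text \<open>Both sides are compared at \<open>z\<close> by pairing with an arbitrary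
  \<open>\<zeta>\<close>. Symmetry turns the left pairing into the conjugate of a Taylor coefficient
  of \<open>kernel_fun K z \<zeta>\<close>; \<open>rep\<close> turns that into a pairing with
  \<open>c\<close>, and the reproducing property evaluates it at \<open>z\<close>.\<close>

lemma scaled_kernel_deriv_eq:
  assumes K: "analytic_kernel K" and c: "c \<in> H"
    and rep: "\<And>f. f \<in> H \<Longrightarrow> ip f c = (deriv ^^ n) (\<lambda>w. cinner (f w) \<eta>) 0 / fact n"
  shows "kernel_deriv K n \<eta> = fact n *\<^sub>C c"
proof
  fix z
  show "kernel_deriv K n \<eta> z = (fact n *\<^sub>C c) z"
  proof (cases "z \<in> disc")
    case False
    then show ?thesis
      using zero_off_disc[OF scaleC_in[OF c] False] by (simp add: kernel_deriv_def on_disc_def)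
  next
    case z: True
    let ?\<phi> = "\<lambda>\<zeta> w. cinner (kernel_fun K z \<zeta> w) \<eta>"
    have eq: "cinner (kernel_deriv K n \<eta> z) \<zeta> = cinner ((fact n *\<^sub>C c) z) \<zeta>" for \<zeta>
    proof -
      have hol: "?\<phi> \<zeta> holomorphic_on disc"
        using z by (intro analytic_vec_on_imp_holomorphic_cinner analytic kernel_fun_in)
      have "cinner (kernel_deriv K n \<eta> z) \<zeta>
          = (deriv ^^ n) (\<lambda>w. cinner (K z (cnj w) \<eta>) \<zeta>) 0"
        using z cinner_higher_deriv_cnj[OF weakly_holomorphic_kernel[OF K z]]
        by (simp add: kernel_deriv_def on_disc_def)
      \<comment> \<open>The symmetry relation holds on the disc only, which suffices since
        derivatives at 0 depend on values near 0.\<close>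
      also have "\<dots> = (deriv ^^ n) (\<lambda>w. cnj (?\<phi> \<zeta> (cnj w))) 0"
      proof (rule higher_deriv_cong_ev)
        have "eventually (\<lambda>w::complex. w \<in> disc) (nhds 0)"
          by (intro eventually_nhds_in_open) auto
        then show "\<forall>\<^sub>F w in nhds 0. cinner (K z (cnj w) \<eta>) \<zeta> = cnj (?\<phi> \<zeta> (cnj w))"
          by eventually_elim
             (use kernel_adjoint[OF z] in \<open>auto simp: kernel_fun_def on_disc_def\<close>)
      qed simp
      also have "\<dots> = cnj ((deriv ^^ n) (?\<phi> \<zeta>) 0)"
        using higher_deriv_cnj_cnj[OF holomorphic_on_subset[OF hol], of disc 0]
        by (simp add: image_subset_iff)
      also have "\<dots> = fact n * cnj (ip (kernel_fun K z \<zeta>) c)"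
        using z by (simp add: rep kernel_fun_in)
      also have "\<dots> = fact n * ip c (kernel_fun K z \<zeta>)"
        by (simp add: ip_commute[OF c kernel_fun_in[OF z]])
      also have "\<dots> = cinner ((fact n *\<^sub>C c) z) \<zeta>"
        using z c by (simp add: reproducing scaleC_fun_def cinner_scaleC_left)
      finally show ?thesis .
    qed
    show ?thesis
    proof (rule cinner.ip_ext)
      show "cinner \<zeta> (kernel_deriv K n \<eta> z) = cinner \<zeta> ((fact n *\<^sub>C c) z)" for \<zeta>
        using arg_cong[OF eq[of \<zeta>], of cnj] by (simp only: flip: cinner_commute)
    qed simp_all
  qed
qed

end

section \<open>The adjoint of multiplication by z on the Taylor coefficient vectors\<close>

theorem theorem3p3:
  fixes K :: "complex \<Rightarrow> complex \<Rightarrow> 'e::complex_hilbert \<Rightarrow>\<^sub>L 'e"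
    and H :: "(complex \<Rightarrow> 'e) set"
    and ip :: "(complex \<Rightarrow> 'e) \<Rightarrow> (complex \<Rightarrow> 'e) \<Rightarrow> complex"
  assumes "analytic_kernel K"
    and "analytic_rkhs K H ip"
    and "bounded_operator_on H ip mult_z"
  shows "\<forall>(n::nat) (\<eta>::'e).
    kernel_deriv K n \<eta> \<in> H \<and>
    adjoint_on H ip mult_z ((1 / fact n) *\<^sub>C kernel_deriv K n \<eta>) =
      (if n \<ge> 1 then (1 / fact (n - 1)) *\<^sub>C kernel_deriv K (n - 1) \<eta> else 0)"
proof (intro allI)
  interpret analytic_rkhs K H ip by fact
  fix n :: nat and \<eta> :: 'e
  define a where "a = (\<lambda>n f. (deriv ^^ n) (\<lambda>w. cinner (f w) \<eta>) 0 / fact n)"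
  have "\<forall>n. \<exists>c. c \<in> H \<and> (\<forall>f\<in>H. ip f c = a n f)"
    unfolding a_def using ex_taylor_coefficient_vector by blast
  then obtain c where c: "\<And>n. c n \<in> H" "\<And>n f. f \<in> H \<Longrightarrow> ip f (c n) = a n f"
    by metis
  have kd: "kernel_deriv K n \<eta> = fact n *\<^sub>C c n" for n
    using c by (intro scaled_kernel_deriv_eq assms(1)) (auto simp: a_def)
  have cn: "(1 / fact n) *\<^sub>C kernel_deriv K n \<eta> = c n" for n
    by (simp add: kd scaleC_scaleC scaleC_one)
  have zf: "mult_z f \<in> H" if "f \<in> H" for f
    using assms(3) that by (simp add: bounded_operator_on_def)
  \<comment> \<open>For \<open>n \<ge> 1\<close> the factor \<open>n\<close> from Leibniz's rule
    cancels against \<open>fact n\<close>, leaving \<open>fact (n - 1)\<close>; for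
    \<open>n = 0\<close> the product with \<open>w\<close> vanishes at 0.\<close>
  have shift: "a n (mult_z f) = (if n \<ge> 1 then a (n - 1) f else 0)" if f: "f \<in> H" for f
  proof -
    let ?\<phi> = "\<lambda>w. cinner (f w) \<eta>"
    have "a n (mult_z f) = of_nat n * (deriv ^^ (n - 1)) ?\<phi> 0 / fact n"
      unfolding a_def mult_z_def cinner_scaleC_left
      using higher_deriv_ident_mult_0[OF
          analytic_vec_on_imp_holomorphic_cinner[OF analytic[OF f]] open_ball]
      by simp
    then show ?thesis
      by (cases n) (simp_all add: a_def del: of_nat_Suc funpow.simps)
  qed
  \<comment> \<open>By \<open>shift\<close>, the functional sending \<open>f\<close> to
    \<open>ip (mult_z f) (c n)\<close> is represented by \<open>c (n - 1)\<close>, or by the zero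
    vector when \<open>n = 0\<close>.\<close>
  have "adjoint_on H ip mult_z (c n) = (if n \<ge> 1 then c (n - 1) else 0)"
    by (rule adjoint_on_eqI) (auto simp: c zf shift zero_in ip_zero_right)
  moreover have "kernel_deriv K n \<eta> \<in> H"
    unfolding kd by (intro scaleC_in c)
  ultimately show "kernel_deriv K n \<eta> \<in> H \<and>
    adjoint_on H ip mult_z ((1 / fact n) *\<^sub>C kernel_deriv K n \<eta>) =
      (if n \<ge> 1 then (1 / fact (n - 1)) *\<^sub>C kernel_deriv K (n - 1) \<eta> else 0)"
    unfolding cn by blast
qed

end
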